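(* Let $w,v,w',v'\in\Sigma^\ast$ with $\mathrm{alph}(w)=\mathrm{alph}(v)$, $\mathrm{alph}(w')=\mathrm{alph}(v')$ and $\mathrm{alph}(w)\cap\mathrm{alph}(w')=\emptyset$. If $|w|_a=|v|_a$ for all $a\in\mathrm{alph}(w)$ and $|w'|_b=|v'|_b$ for all $b\in\mathrm{alph}(w')$, then the join $G(w,v)\nabla G(w',v')$ equals $G(ww',vv')$.
   Context: $\Sigma$ is a finite alphabet; $\mathrm{alph}(w)$ is the set of letters occurring in $w$ and $|w|_a$ the number of occurrences of $a$ in $w$. For letters $a,b$, $\pi_{a,b}$ is the monoid morphism on $\Sigma^\ast$ with $a\mapsto a$, $b\mapsto b$ and all other letters mapped to the empty word. For words $w,v$ with $\mathrm{alph}(w)=\mathrm{alph}(v)=A$, $G(w,v)$ is the undirected simple graph on vertex set $A$ in which distinct $a,b$ are adjacent iff $\pi_{a,b}(w)=\pi_{a,b}(v)$. For graphs $G=(V,E)$, $G'=(V',E')$ with disjoint vertex sets, the join $G\nabla G'$ has vertex set $V\cup V'$ and edge set $E\cup E'\cup\{\{u,u'\}: u\in V, u'\in V'\}$. *)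

theory Defs
  imports Main
begin

text \<open>
  Words over an alphabet \<open>\<Sigma>\<close> are lists in \<open>lists \<Sigma>\<close>; \<open>alph w\<close> is \<open>set w\<close> and the number of
  occurrences of \<open>a\<close> in \<open>w\<close> is \<open>count_list w a\<close>.
  An undirected simple graph is a pair of a vertex set and a set of two-element sets of vertices.
\<close>

type_synonym 'a ugraph = "'a set \<times> 'a set set"

definition proj2 :: "'a \<Rightarrow> 'a \<Rightarrow> 'a list \<Rightarrow> 'a list" where
  "proj2 a b w = concat (map (\<lambda>c. if c = a then [a] else if c = b then [b] else []) w)"

lemma proj2_Nil: "proj2 a b [] = []"
  by (simp add: proj2_def)

lemma proj2_append: "proj2 a b (u @ w) = proj2 a b u @ proj2 a b w"
  by (simp add: proj2_def)

lemma proj2_commute: "proj2 a b w = proj2 b a w"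
  unfolding proj2_def by (rule arg_cong[where f = concat]) auto

text \<open>Only meaningful if \<open>set w = set v\<close>, in which case this common set is the vertex set.\<close>

definition proj_graph :: "'a list \<Rightarrow> 'a list \<Rightarrow> 'a ugraph" where
  "proj_graph w v =
     (set w, {{a, b} | a b. a \<in> set w \<and> b \<in> set w \<and> a \<noteq> b \<and> proj2 a b w = proj2 a b v})"

text \<open>Only meaningful for graphs with disjoint vertex sets.\<close>

definition graph_join :: "'a ugraph \<Rightarrow> 'a ugraph \<Rightarrow> 'a ugraph" (infixl \<open>\<nabla>\<close> 65) where
  "G \<nabla> G' =
     (fst G \<union> fst G', snd G \<union> snd G' \<union> {{u, u'} | u u'. u \<in> fst G \<and> u' \<in> fst G'})"

end

theory Submission
  imports Defs
begin

text \<open>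
  If \<open>V\<close> and \<open>V'\<close> are the vertex sets of \<open>G\<close> and \<open>G'\<close>, then the join is the simple graph on
  \<open>V \<union> V'\<close> that agrees with \<open>G\<close> inside \<open>V\<close> and with \<open>G'\<close> inside \<open>V'\<close> and has every edge across.
  The graph of \<open>ww'\<close> and \<open>vv'\<close> is of this kind: projecting to two letters of \<open>w\<close> erases \<open>w'\<close> and
  \<open>v'\<close>, projecting to two letters of \<open>w'\<close> erases \<open>w\<close> and \<open>v\<close>, and projecting to a letter \<open>a\<close> of
  \<open>w\<close> and a letter \<open>b\<close> of \<open>w'\<close> yields words \<open>a\<^sup>mb\<^sup>n\<close> whose exponents count the occurrences of \<open>a\<close>
  and \<open>b\<close>.
\<close>

lemma proj2_eq_filter: "proj2 a b w = filter (\<lambda>c. c = a \<or> c = b) w"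
  by (induction w) (auto simp: proj2_def)

lemma proj2_append_left:
  assumes "a \<notin> set w'" and "b \<notin> set w'"
  shows "proj2 a b (w @ w') = proj2 a b w"
  using assms by (auto simp: proj2_eq_filter filter_empty_conv)

lemma proj2_append_right:
  assumes "a \<notin> set w" and "b \<notin> set w"
  shows "proj2 a b (w @ w') = proj2 a b w'"
  using assms by (auto simp: proj2_eq_filter filter_empty_conv)

lemma proj2_eq_replicate:
  assumes "b \<notin> set w"
  shows "proj2 a b w = replicate (count_list w a) a"
proof -
  have "proj2 a b w = filter ((=) a) w"
    unfolding proj2_eq_filter using assms by (intro filter_cong) auto
  then show ?thesis
    by (simp add: replicate_length_filter count_list_eq_length_filter)
qed

lemma proj2_append_eq_replicate_append:
  assumes "b \<notin> set w" and "a \<notin> set w'"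
  shows "proj2 a b (w @ w') = replicate (count_list w a) a @ replicate (count_list w' b) b"
  using assms proj2_eq_replicate[of b w a] proj2_eq_replicate[of a w' b]
  by (simp add: proj2_append proj2_commute[of a b w'])

lemma count_list_proj2:
  "count_list (proj2 a b w) a = count_list w a"
  "count_list (proj2 a b w) b = count_list w b"
  by (induction w) (simp_all add: proj2_eq_filter)

lemma proj2_append_eq_iff_count_list_eq:
  assumes "b \<notin> set w" and "a \<notin> set w'" and "b \<notin> set v" and "a \<notin> set v'"
  shows "proj2 a b (w @ w') = proj2 a b (v @ v') \<longleftrightarrow>
    count_list w a = count_list v a \<and> count_list w' b = count_list v' b"
proof
  assume eq: "proj2 a b (w @ w') = proj2 a b (v @ v')"
  have "count_list (w @ w') a = count_list (v @ v') a"
    and "count_list (w @ w') b = count_list (v @ v') b"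
    using eq by (metis count_list_proj2)+
  then show "count_list w a = count_list v a \<and> count_list w' b = count_list v' b"
    using assms by simp
next
  assume "count_list w a = count_list v a \<and> count_list w' b = count_list v' b"
  then show "proj2 a b (w @ w') = proj2 a b (v @ v')"
    using assms by (simp add: proj2_append_eq_replicate_append)
qed

definition simple_ugraph :: "'a ugraph \<Rightarrow> bool" where
  "simple_ugraph G \<longleftrightarrow> (\<forall>e \<in> snd G. e \<subseteq> fst G \<and> card e = 2)"

lemma simple_ugraph_edgeE:
  assumes "simple_ugraph G" and "e \<in> snd G"
  obtains a b where "e = {a, b}" and "a \<in> fst G" and "b \<in> fst G"
proof -
  have "e \<subseteq> fst G" and "card e = 2"
    using assms by (auto simp: simple_ugraph_def)
  then show thesis
    using that by (auto simp: card_2_iff)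
qed

lemma graph_join_eqI:
  assumes simple: "simple_ugraph G" "simple_ugraph G'" "simple_ugraph H"
    and vertices: "fst H = fst G \<union> fst G'"
    and left: "\<And>a b. a \<in> fst G \<Longrightarrow> b \<in> fst G \<Longrightarrow> {a, b} \<in> snd H \<longleftrightarrow> {a, b} \<in> snd G"
    and right: "\<And>a b. a \<in> fst G' \<Longrightarrow> b \<in> fst G' \<Longrightarrow> {a, b} \<in> snd H \<longleftrightarrow> {a, b} \<in> snd G'"
    and across: "\<And>a b. a \<in> fst G \<Longrightarrow> b \<in> fst G' \<Longrightarrow> {a, b} \<in> snd H"
  shows "G \<nabla> G' = H"
proof (rule prod_eqI)
  show "fst (G \<nabla> G') = fst H"
    by (simp add: graph_join_def vertices)
  let ?across = "{{a, b} | a b. a \<in> fst G \<and> b \<in> fst G'}"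
  have "snd G \<subseteq> snd H"
    using left by (metis subsetI simple_ugraph_edgeE[OF simple(1)])
  moreover have "snd G' \<subseteq> snd H"
    using right by (metis subsetI simple_ugraph_edgeE[OF simple(2)])
  moreover have "?across \<subseteq> snd H"
    using across by auto
  moreover have "snd H \<subseteq> snd G \<union> snd G' \<union> ?across"
  proof
    fix e assume "e \<in> snd H"
    then obtain a b where e: "e = {a, b}"
      and ab: "a \<in> fst G \<union> fst G'" "b \<in> fst G \<union> fst G'"
      using simple_ugraph_edgeE[OF simple(3)] vertices by metis
    consider (both_left) "a \<in> fst G" "b \<in> fst G" | (both_right) "a \<in> fst G'" "b \<in> fst G'"
      | (crossing) "e \<in> ?across"
      using e ab by (auto simp: insert_commute)
    then show "e \<in> snd G \<union> snd G' \<union> ?across"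
      by cases (use \<open>e \<in> snd H\<close> e left right in auto)
  qed
  ultimately have "snd G \<union> snd G' \<union> ?across = snd H"
    by (intro equalityI Un_least)
  then show "snd (G \<nabla> G') = snd H"
    by (simp add: graph_join_def)
qed

lemma fst_proj_graph [simp]: "fst (proj_graph w v) = set w"
  by (simp add: proj_graph_def)

lemma simple_ugraph_proj_graph: "simple_ugraph (proj_graph w v)"
  by (auto simp: simple_ugraph_def proj_graph_def)

lemma doubleton_in_proj_graph_iff:
  "{a, b} \<in> snd (proj_graph w v) \<longleftrightarrow>
    a \<in> set w \<and> b \<in> set w \<and> a \<noteq> b \<and> proj2 a b w = proj2 a b v"
  by (auto simp: proj_graph_def doubleton_eq_iff proj2_commute)

lemma proj_graph_append_edge_left:
  assumes "set w \<inter> set w' = {}" and "set w \<inter> set v' = {}"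
    and "a \<in> set w" and "b \<in> set w"
  shows "{a, b} \<in> snd (proj_graph (w @ w') (v @ v')) \<longleftrightarrow> {a, b} \<in> snd (proj_graph w v)"
proof -
  have "proj2 a b (w @ w') = proj2 a b w" and "proj2 a b (v @ v') = proj2 a b v"
    using assms by (auto intro!: proj2_append_left)
  then show ?thesis
    using assms by (simp add: doubleton_in_proj_graph_iff)
qed

lemma proj_graph_append_edge_right:
  assumes "set w \<inter> set w' = {}" and "set v \<inter> set w' = {}"
    and "a \<in> set w'" and "b \<in> set w'"
  shows "{a, b} \<in> snd (proj_graph (w @ w') (v @ v')) \<longleftrightarrow> {a, b} \<in> snd (proj_graph w' v')"
proof -
  have "proj2 a b (w @ w') = proj2 a b w'" and "proj2 a b (v @ v') = proj2 a b v'"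
    using assms by (auto intro!: proj2_append_right)
  then show ?thesis
    using assms by (simp add: doubleton_in_proj_graph_iff)
qed

lemma proj_graph_append_edge_across:
  assumes "set w \<inter> set w' = {}" and "set v \<inter> set w' = {}" and "set w \<inter> set v' = {}"
    and "a \<in> set w" and "b \<in> set w'"
  shows "{a, b} \<in> snd (proj_graph (w @ w') (v @ v')) \<longleftrightarrow>
    count_list w a = count_list v a \<and> count_list w' b = count_list v' b"
proof -
  have "b \<notin> set w" "a \<notin> set w'" "b \<notin> set v" "a \<notin> set v'"
    using assms by auto
  note proj2_append_eq_iff_count_list_eq[OF this]
  moreover have "a \<noteq> b"
    using assms by auto
  ultimately show ?thesis
    using assms by (simp add: doubleton_in_proj_graph_iff)
qed

theorem theorem10:
  fixes \<Sigma> :: "'a set" and w v w' v' :: "'a list"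
  assumes "finite \<Sigma>"
    and "w \<in> lists \<Sigma>" and "v \<in> lists \<Sigma>" and "w' \<in> lists \<Sigma>" and "v' \<in> lists \<Sigma>"
    and "set w = set v" and "set w' = set v'" and "set w \<inter> set w' = {}"
    and "\<forall>a \<in> set w. count_list w a = count_list v a"
    and "\<forall>b \<in> set w'. count_list w' b = count_list v' b"
  shows "proj_graph w v \<nabla> proj_graph w' v' = proj_graph (w @ w') (v @ v')"
proof (rule graph_join_eqI)
  have disjoint: "set w \<inter> set w' = {}" "set w \<inter> set v' = {}" "set v \<inter> set w' = {}"
    using assms(6-8) by auto
  fix a b
  let ?edges = "snd (proj_graph (w @ w') (v @ v'))"
  show "{a, b} \<in> ?edges \<longleftrightarrow> {a, b} \<in> snd (proj_graph w v)"
    if "a \<in> fst (proj_graph w v)" "b \<in> fst (proj_graph w v)"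
    using that proj_graph_append_edge_left[OF disjoint(1,2)] by simp
  show "{a, b} \<in> ?edges \<longleftrightarrow> {a, b} \<in> snd (proj_graph w' v')"
    if "a \<in> fst (proj_graph w' v')" "b \<in> fst (proj_graph w' v')"
    using that proj_graph_append_edge_right[OF disjoint(1,3)] by simp
  show "{a, b} \<in> ?edges" if "a \<in> fst (proj_graph w v)" "b \<in> fst (proj_graph w' v')"
    using that assms(9,10) proj_graph_append_edge_across[OF disjoint(1,3,2)] by simp
qed (simp_all add: simple_ugraph_proj_graph)

end
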